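(* Let $(X,r)$ be an involutive non-degenerate set-theoretic solution to the Yang--Baxter equation, let $V=\mathbb{C}X$ and denote also by $r$ the linear extension of $r$ to $V\otimes V$. Let $k\colon V\to V$ be a linear map that is a reflection of $(V,r)$, i.e. $rK_2rK_2=K_2rK_2r$ where $K_2=\mathrm{id}\otimes k$. Assume that either $k^2=\mathrm{id}$ or $k^2=0$. For $u\in\mathbb{C}$ let $R(u)=\mathrm{id}+ur$, $K(u)=\mathrm{id}+uk$ and $K_2(u)=\mathrm{id}\otimes K(u)$. Then $K(u)$ satisfies the reflection equation $$K_{2}(v)R(u+v)K_{2}(u)R(u-v)=R(u-v)K_{2}(u)R(u+v)K_{2}(v)$$ for all $u,v\in\mathbb{C}$.
   Context: A set-theoretic solution to the Yang--Baxter equation is a pair $(X,r)$, where $X$ is a set and $r\colon X\times X\to X\times X$ is bijective with $(r\times\mathrm{id})(\mathrm{id}\times r)(r\times\mathrm{id})=(\mathrm{id}\times r)(r\times\mathrm{id})(\mathrm{id}\times r)$. Write $r(x,y)=(\sigma_x(y),\tau_y(x))$; the solution is non-degenerate if all $\sigma_x,\tau_x\colon X\to X$ are bijective, and involutive if $r^2=\mathrm{id}$. $V=\mathbb{C}X$ is the complex vector space with basis $X$, and the linear extension $r\colon V\otimes V\to V\otimes V$ is given by $r(x\otimes y)=\sigma_x(y)\otimes\tau_y(x)$ for $x,y\in X$. *)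

theory Defs
  imports Complex_Main "HOL-Library.Poly_Mapping"
begin

definition sigma :: "('x \<times> 'x \<Rightarrow> 'x \<times> 'x) \<Rightarrow> 'x \<Rightarrow> 'x \<Rightarrow> 'x" where
  "sigma r x y = fst (r (x, y))"

definition tau :: "('x \<times> 'x \<Rightarrow> 'x \<times> 'x) \<Rightarrow> 'x \<Rightarrow> 'x \<Rightarrow> 'x" where
  "tau r y x = snd (r (x, y))"

text \<open>The maps \<open>r \<times> id\<close> and \<open>id \<times> r\<close> on \<open>X \<times> X \<times> X\<close>; triples associate to the right.\<close>

definition r12 :: "('x \<times> 'x \<Rightarrow> 'x \<times> 'x) \<Rightarrow> 'x \<times> 'x \<times> 'x \<Rightarrow> 'x \<times> 'x \<times> 'x" where
  "r12 r = (\<lambda>(x, y, z). (fst (r (x, y)), snd (r (x, y)), z))"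

definition r23 :: "('x \<times> 'x \<Rightarrow> 'x \<times> 'x) \<Rightarrow> 'x \<times> 'x \<times> 'x \<Rightarrow> 'x \<times> 'x \<times> 'x" where
  "r23 r = (\<lambda>(x, y, z). (x, r (y, z)))"

definition set_theoretic_solution :: "('x \<times> 'x \<Rightarrow> 'x \<times> 'x) \<Rightarrow> bool" where
  "set_theoretic_solution r \<longleftrightarrow>
     bij r \<and> r12 r \<circ> r23 r \<circ> r12 r = r23 r \<circ> r12 r \<circ> r23 r"

definition non_degenerate :: "('x \<times> 'x \<Rightarrow> 'x \<times> 'x) \<Rightarrow> bool" where
  "non_degenerate r \<longleftrightarrow> (\<forall>x. bij (sigma r x)) \<and> (\<forall>y. bij (tau r y))"

definition involutive :: "('x \<times> 'x \<Rightarrow> 'x \<times> 'x) \<Rightarrow> bool" where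
  "involutive r \<longleftrightarrow> r \<circ> r = id"

text \<open>The complex vector space with basis \<open>'b\<close> consists of the finitely supported functions
  \<open>'b \<Rightarrow>\<^sub>0 complex\<close>, a basis element \<open>b\<close> being identified with \<open>basis b\<close>. No finiteness of
  \<open>'b\<close> is assumed.\<close>

type_synonym 'b free_space = "'b \<Rightarrow>\<^sub>0 complex"

abbreviation lookup :: "'b free_space \<Rightarrow> 'b \<Rightarrow> complex" where
  "lookup \<equiv> Poly_Mapping.lookup"

abbreviation keys :: "'b free_space \<Rightarrow> 'b set" where
  "keys \<equiv> Poly_Mapping.keys"

definition basis :: "'b \<Rightarrow> 'b free_space" where
  "basis b = Poly_Mapping.single b 1"

definition scale :: "complex \<Rightarrow> 'b free_space \<Rightarrow> 'b free_space" where
  "scale c v = Poly_Mapping.map (\<lambda>a. c * a) v"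

lemma lookup_scale [simp]: "lookup (scale c v) b = c * lookup v b"
  unfolding scale_def by (auto simp: Poly_Mapping.map.rep_eq when_def)

global_interpretation free: vector_space "scale :: complex \<Rightarrow> 'b free_space \<Rightarrow> 'b free_space"
  by unfold_locales
    (auto intro!: poly_mapping_eqI simp: lookup_add algebra_simps)

definition linear_extension :: "('b \<Rightarrow> 'c free_space) \<Rightarrow> 'b free_space \<Rightarrow> 'c free_space" where
  "linear_extension f v = (\<Sum>b\<in>keys v. scale (lookup v b) (f b))"

lemma linear_extension_superset:
  assumes "finite S" "keys v \<subseteq> S"
  shows "linear_extension f v = (\<Sum>b\<in>S. scale (lookup v b) (f b))"
  unfolding linear_extension_def using assms
  by (intro sum.mono_neutral_left) (auto simp: in_keys_iff)

lemma linear_linear_extension: "Vector_Spaces.linear scale scale (linear_extension f)"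
proof unfold_locales
  fix v w :: "'a free_space"
  let ?S = "keys v \<union> keys w"
  have "keys (v + w) \<subseteq> ?S" by (rule keys_add)
  then show "linear_extension f (v + w) = linear_extension f v + linear_extension f w"
    by (simp add: linear_extension_superset[of ?S] lookup_add free.scale_left_distrib sum.distrib)
next
  fix c and v :: "'a free_space"
  have "keys (scale c v) \<subseteq> keys v" by (auto simp: in_keys_iff)
  then show "linear_extension f (scale c v) = scale c (linear_extension f v)"
    by (simp add: linear_extension_superset[of "keys v"] free.scale_sum_right)
qed

lemma linear_extension_basis [simp]: "linear_extension f (basis b) = f b"
  by (simp add: linear_extension_def basis_def)

lemma free_space_expand: "v = (\<Sum>b\<in>keys v. scale (lookup v b) (basis b))"
proof (rule poly_mapping_eqI)
  fix k
  show "lookup v k = lookup (\<Sum>b\<in>keys v. scale (lookup v b) (basis b)) k"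
    by (cases "k \<in> keys v")
      (auto simp: lookup_sum basis_def lookup_single when_def in_keys_iff sum.delta'
            if_distrib[of "\<lambda>x. _ * x"] cong: if_cong)
qed

lemma linear_eq_linear_extension:
  assumes "Vector_Spaces.linear scale scale g"
  shows "g = linear_extension (\<lambda>b. g (basis b))"
proof
  fix v
  interpret g: Vector_Spaces.linear scale scale g by fact
  have "g v = g (\<Sum>b\<in>keys v. scale (lookup v b) (basis b))"
    using free_space_expand[of v] by simp
  then show "g v = linear_extension (\<lambda>b. g (basis b)) v"
    by (simp add: linear_extension_def g.sum g.scale)
qed

text \<open>The tensor product of the spaces with bases \<open>'b\<close> and \<open>'c\<close> is realised as the space with
  basis \<open>'b \<times> 'c\<close>, where \<open>basis (x, y)\<close> plays the role of \<open>x \<otimes> y\<close>. \<open>tensor_map f g\<close> is the map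
  \<open>f \<otimes> g\<close>, meaningful for linear \<open>f\<close> and \<open>g\<close>; see \<open>tensor_map_tensor\<close> below.\<close>

definition tensor :: "'b free_space \<Rightarrow> 'c free_space \<Rightarrow> ('b \<times> 'c) free_space" where
  "tensor v w = (\<Sum>x\<in>keys v. \<Sum>y\<in>keys w. scale (lookup v x * lookup w y) (basis (x, y)))"

definition tensor_map ::
  "('b free_space \<Rightarrow> 'd free_space) \<Rightarrow> ('c free_space \<Rightarrow> 'e free_space)
    \<Rightarrow> ('b \<times> 'c) free_space \<Rightarrow> ('d \<times> 'e) free_space" where
  "tensor_map f g = linear_extension (\<lambda>(x, y). tensor (f (basis x)) (g (basis y)))"

lemma lookup_tensor: "lookup (tensor v w) (x, y) = lookup v x * lookup w y"
proof -
  have "lookup (tensor v w) (x, y) =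
      (\<Sum>a\<in>keys v. \<Sum>b\<in>keys w. if a = x then if b = y then lookup v a * lookup w b else 0 else 0)"
    unfolding tensor_def
    by (auto simp: lookup_sum basis_def lookup_single when_def intro!: sum.cong)
  also have "\<dots> = (\<Sum>a\<in>keys v. if a = x then lookup v a * lookup w y else 0)"
    by (intro sum.cong refl) (auto simp: in_keys_iff)
  also have "\<dots> = lookup v x * lookup w y"
    by (auto simp: in_keys_iff)
  finally show ?thesis .
qed

lemma linear_tensor_left: "Vector_Spaces.linear scale scale (\<lambda>v. tensor v w)"
  by unfold_locales
    (auto intro!: poly_mapping_eqI simp: lookup_tensor lookup_add algebra_simps)

lemma linear_tensor_right: "Vector_Spaces.linear scale scale (tensor v)"
  by unfold_locales
    (auto intro!: poly_mapping_eqI simp: lookup_tensor lookup_add algebra_simps)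

lemma tensor_basis: "tensor (basis x) (basis y) = basis (x, y)"
  by (auto intro!: poly_mapping_eqI simp: lookup_tensor basis_def lookup_single when_def)

lemma tensor_map_tensor:
  assumes "Vector_Spaces.linear scale scale f" "Vector_Spaces.linear scale scale g"
  shows "tensor_map f g (tensor v w) = tensor (f v) (g w)"
proof -
  interpret f: Vector_Spaces.linear scale scale f by fact
  interpret g: Vector_Spaces.linear scale scale g by fact
  interpret L: Vector_Spaces.linear scale scale "tensor_map f g"
    unfolding tensor_map_def by (rule linear_linear_extension)
  interpret tl: Vector_Spaces.linear scale scale "\<lambda>v. tensor v w'" for w' :: "'e free_space"
    by (rule linear_tensor_left)
  interpret tr: Vector_Spaces.linear scale scale "tensor v'" for v' :: "'b free_space"
    by (rule linear_tensor_right)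
  have "tensor_map f g (tensor v w) =
      (\<Sum>x\<in>keys v. \<Sum>y\<in>keys w.
         scale (lookup v x * lookup w y) (tensor (f (basis x)) (g (basis y))))"
    by (simp add: tensor_def[of v w] L.sum L.scale) (simp add: tensor_map_def)
  also have "\<dots> = tensor (\<Sum>x\<in>keys v. scale (lookup v x) (f (basis x)))
                       (\<Sum>y\<in>keys w. scale (lookup w y) (g (basis y)))"
    by (subst sum.swap)
      (simp add: tl.sum tl.scale tr.sum tr.scale free.scale_sum_right mult.commute)
  also have "\<dots> = tensor (f v) (g w)"
    using linear_eq_linear_extension[OF assms(1)] linear_eq_linear_extension[OF assms(2)]
    by (metis linear_extension_def)
  finally show ?thesis .
qed

definition linearize ::
  "('x \<times> 'x \<Rightarrow> 'x \<times> 'x) \<Rightarrow> ('x \<times> 'x) free_space \<Rightarrow> ('x \<times> 'x) free_space" where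
  "linearize r = linear_extension (\<lambda>(x, y). tensor (basis (sigma r x y)) (basis (tau r y x)))"

definition on_second :: "('x free_space \<Rightarrow> 'x free_space)
    \<Rightarrow> ('x \<times> 'x) free_space \<Rightarrow> ('x \<times> 'x) free_space" where
  "on_second k = tensor_map id k"

definition is_reflection ::
  "('x \<times> 'x \<Rightarrow> 'x \<times> 'x) \<Rightarrow> ('x free_space \<Rightarrow> 'x free_space) \<Rightarrow> bool" where
  "is_reflection r k \<longleftrightarrow>
     linearize r \<circ> on_second k \<circ> linearize r \<circ> on_second k =
     on_second k \<circ> linearize r \<circ> on_second k \<circ> linearize r"

definition R_op ::
  "('x \<times> 'x \<Rightarrow> 'x \<times> 'x) \<Rightarrow> complex \<Rightarrow> ('x \<times> 'x) free_space \<Rightarrow> ('x \<times> 'x) free_space" where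
  "R_op r u = (\<lambda>w. w + scale u (linearize r w))"

definition K_op :: "('x free_space \<Rightarrow> 'x free_space) \<Rightarrow> complex \<Rightarrow> 'x free_space \<Rightarrow> 'x free_space" where
  "K_op k u = (\<lambda>v. v + scale u (k v))"

definition K2_op :: "('x free_space \<Rightarrow> 'x free_space)
    \<Rightarrow> complex \<Rightarrow> ('x \<times> 'x) free_space \<Rightarrow> ('x \<times> 'x) free_space" where
  "K2_op k u = on_second (K_op k u)"

end

theory Submission
  imports Defs
begin

text \<open>Both sides are expanded using linearity, \<open>r\<^sup>2 = id\<close>, \<open>k\<^sup>2 = c id\<close> with \<open>c \<in> {0, 1}\<close>, and
  the reflection identity for the term of degree four. The two expansions are mirror images of each
  other, so only the coefficients of \<open>K\<^sub>2 r\<close> and \<open>r K\<^sub>2\<close> could differ; they agree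
  because \<open>u (u - v) + v ((u + v) + (u - v)) = u (u + v)\<close>.\<close>

text \<open>Both maps are the linear extension of the same values on the basis. The operator
  identities below are reduced to basis vectors this way.\<close>

lemma linear_ext_basis:
  assumes "Vector_Spaces.linear scale scale f" "Vector_Spaces.linear scale scale g"
    and "\<And>b. f (basis b) = g (basis b)"
  shows "f = g"
  using linear_eq_linear_extension[OF assms(1)] linear_eq_linear_extension[OF assms(2)] assms(3)
  by simp

lemma linear_linearize: "Vector_Spaces.linear scale scale (linearize r)"
  unfolding linearize_def by (rule linear_linear_extension)

lemma linearize_basis: "linearize r (basis p) = basis (r p)"
  by (cases p) (simp add: linearize_def tensor_basis sigma_def tau_def)

lemma linearize_involutive:
  assumes "involutive r"
  shows "linearize r (linearize r w) = w"
proof -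
  have "linearize r \<circ> linearize r = id"
  proof (rule linear_ext_basis)
    show "Vector_Spaces.linear scale scale (linearize r \<circ> linearize r)"
      by (rule Vector_Spaces.linear_compose[OF linear_linearize linear_linearize])
    show "Vector_Spaces.linear scale scale id"
      by (rule free.linear_id)
    show "(linearize r \<circ> linearize r) (basis b) = id (basis b)" for b
      using assms by (simp add: linearize_basis involutive_def pointfree_idE)
  qed
  then show ?thesis by (simp add: fun_eq_iff)
qed

lemma linear_on_second: "Vector_Spaces.linear scale scale (on_second k)"
  unfolding on_second_def tensor_map_def by (rule linear_linear_extension)

lemma on_second_basis: "on_second k (basis (x, y)) = tensor (basis x) (k (basis y))"
  by (simp add: on_second_def tensor_map_def)

lemma on_second_tensor:
  assumes "Vector_Spaces.linear scale scale k"
  shows "on_second k (tensor v w) = tensor v (k w)"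
  using tensor_map_tensor[OF free.linear_id assms] by (simp add: on_second_def)

text \<open>On \<open>basis (x, y)\<close> the map \<open>k\<close> acts twice on the second factor,
  and the scalar \<open>c\<close> then moves out of the tensor by linearity in that factor.\<close>

lemma on_second_on_second:
  assumes "Vector_Spaces.linear scale scale k" and "\<And>v. k (k v) = scale c v"
  shows "on_second k (on_second k w) = scale c w"
proof -
  have "on_second k \<circ> on_second k = scale c"
  proof (rule linear_ext_basis)
    show "Vector_Spaces.linear scale scale (on_second k \<circ> on_second k)"
      by (rule Vector_Spaces.linear_compose[OF linear_on_second linear_on_second])
    show "Vector_Spaces.linear scale scale (scale c)"
      by (rule free.linear_scale_self)
    show "(on_second k \<circ> on_second k) (basis b) = scale c (basis b)" for b
    proof (cases b)
      case (Pair x y)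
      interpret t: Vector_Spaces.linear scale scale "tensor (basis x)"
        by (rule linear_tensor_right)
      show ?thesis
        using assms
        by (simp add: Pair on_second_basis on_second_tensor t.scale tensor_basis)
    qed
  qed
  then show ?thesis by (simp add: fun_eq_iff)
qed

text \<open>The tensor product is linear in its second factor, so id \<otimes> (id + u k) splits on
  basis vectors. This makes the K-factors polynomial in \<open>on_second k\<close>, just as
  \<open>R_op\<close> is in \<open>linearize r\<close>.\<close>

lemma K2_op_eq: "K2_op k u w = w + scale u (on_second k w)"
proof -
  interpret K: Vector_Spaces.linear scale scale "on_second k"
    by (rule linear_on_second)
  have "K2_op k u = (\<lambda>w. w + scale u (on_second k w))"
  proof (rule linear_ext_basis)
    show "Vector_Spaces.linear scale scale (K2_op k u)"
      unfolding K2_op_def by (rule linear_on_second)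
    show "Vector_Spaces.linear scale scale (\<lambda>w. w + scale u (on_second k w))"
      by unfold_locales
        (auto intro!: poly_mapping_eqI simp: K.add K.scale lookup_add algebra_simps)
    show "K2_op k u (basis b) = basis b + scale u (on_second k (basis b))" for b
    proof (cases b)
      case (Pair x y)
      interpret t: Vector_Spaces.linear scale scale "tensor (basis x)"
        by (rule linear_tensor_right)
      show ?thesis
        by (simp add: Pair K2_op_def K_op_def on_second_basis t.add t.scale tensor_basis)
    qed
  qed
  then show ?thesis by simp
qed

theorem theorem5p11:
  fixes r :: "'x \<times> 'x \<Rightarrow> 'x \<times> 'x"
    and k :: "'x free_space \<Rightarrow> 'x free_space"
  assumes "set_theoretic_solution r"
    and "non_degenerate r"
    and "involutive r"
    and "Vector_Spaces.linear scale scale k"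
    and "is_reflection r k"
    and "k \<circ> k = id \<or> k \<circ> k = (\<lambda>_. 0)"
  shows "\<forall>u v :: complex.
    K2_op k v \<circ> R_op r (u + v) \<circ> K2_op k u \<circ> R_op r (u - v) =
    R_op r (u - v) \<circ> K2_op k u \<circ> R_op r (u + v) \<circ> K2_op k v"
proof (intro allI ext)
  fix u v :: complex and w
  interpret R: Vector_Spaces.linear scale scale "linearize r"
    by (rule linear_linearize)
  interpret K: Vector_Spaces.linear scale scale "on_second k"
    by (rule linear_on_second)
  \<comment> \<open>The two alternatives for \<open>k\<close> become c = 1 and c = 0, so a single
    computation covers both.\<close>
  obtain c where c: "\<And>x. k (k x) = scale c x"
  proof (cases "k \<circ> k = id")
    case True
    then show ?thesis using that[of 1] by (simp add: fun_eq_iff)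
  next
    case False
    then show ?thesis using that[of 0] assms(6) by (auto simp: fun_eq_iff)
  qed
  note KK = on_second_on_second[OF assms(4) c]
  note RR = linearize_involutive[OF assms(3)]
  \<comment> \<open>Oriented so that rewriting turns the degree-four term of the left side into that
    of the right.\<close>
  have KRKR: "on_second k (linearize r (on_second k (linearize r w))) =
      linearize r (on_second k (linearize r (on_second k w)))"
    using assms(5) by (simp add: is_reflection_def fun_eq_iff)
  show "(K2_op k v \<circ> R_op r (u + v) \<circ> K2_op k u \<circ> R_op r (u - v)) w =
    (R_op r (u - v) \<circ> K2_op k u \<circ> R_op r (u + v) \<circ> K2_op k v) w"
    \<comment> \<open>Comparing coefficients at each basis element leaves an identity of complex
      numbers: the first call expands the operators, the second normalises the polynomials in u and
      v.\<close>
    by (rule poly_mapping_eqI)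
      (simp add: K2_op_eq R_op_def R.add R.scale K.add K.scale KK RR KRKR lookup_add,
        simp add: algebra_simps)
qed

end
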